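(* Let $1 < p \leq 2$, and for $j=1,2$ let $$\tilde{T}_j h(x) := \frac{1}{2\pi} \int_{\mathbb{R}^2} \left[\frac{y_j - x_j}{|y-x|} - \frac{y_j}{|y|}\right] h(y) \, dy, \qquad x\in\mathbb{R}^2.$$ (i) If $1 < p < 2$, then there exists a constant $C = C(p)$ such that $$|\tilde{T}_j h(x) - \tilde{T}_j h(z)| \leq C|x-z|^{2-\frac{2}{p}} \|h\|_{L^p(\mathbb{R}^2)}$$ for all $x,z\in\mathbb{R}^2$, all $h \in L^p(\mathbb{R}^2)$ and $j = 1, 2$. (ii) If $p = 2$ and $1 \leq q < 2$, then there exists a constant $C = C(q)$ such that $$|\tilde{T}_j h(x) - \tilde{T}_j h(z)| \leq C|x-z|\left(\left|\ln|x-z|\right| + 1\right)^{\frac{1}{2}} \left(\|h\|_{L^2(\mathbb{R}^2)} + \|h\|_{L^q(\mathbb{R}^2)}\right)$$ for all $x,z\in\mathbb{R}^2$, all $h \in L^2(\mathbb{R}^2) \cap L^q(\mathbb{R}^2)$ and $j = 1, 2$.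
   Context: Here $x=(x_1,x_2)$, $y=(y_1,y_2)\in\mathbb{R}^2$ and $|\cdot|$ is the Euclidean norm. When $x=z$ the right-hand side of (ii) is interpreted as $0$. *)

theory Defs
  imports "HOL-Analysis.Analysis"
begin

text \<open>
  The spaces \<open>L\<^sup>p\<close> for \<open>1 \<le> p < \<infinity>\<close> over Lebesgue measure, given by representatives:
  functions equal almost everywhere are not identified. The power
  \<open>0 powr p\<close> is \<open>0\<close> for every \<open>p\<close>.
\<close>

definition Lp_fun :: "real \<Rightarrow> ('a::euclidean_space \<Rightarrow> real) \<Rightarrow> bool" where
  "Lp_fun p h \<longleftrightarrow>
     h \<in> borel_measurable lebesgue \<and> integrable lebesgue (\<lambda>y. \<bar>h y\<bar> powr p)"

definition Lp_norm :: "real \<Rightarrow> ('a::euclidean_space \<Rightarrow> real) \<Rightarrow> real" where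
  "Lp_norm p h = (LINT y|lebesgue. \<bar>h y\<bar> powr p) powr (1 / p)"

text \<open>
  The index \<open>j\<close> ranges over the two-element type \<open>2\<close> (elements \<open>1\<close> and \<open>2\<close>).
  At the null set \<open>y = x\<close> or \<open>y = 0\<close> the respective quotient is \<open>0 / 0 = 0\<close>.
  The kernel is bounded and is \<open>O(1 / norm y)\<close> at infinity (for fixed \<open>x\<close>), hence it lies in
  \<open>L\<^sup>r\<close> for every \<open>2 < r \<le> \<infinity>\<close>; by Hoelder the integral converges absolutely
  whenever \<open>h\<close> is in \<open>L\<^sup>p\<close> for some \<open>1 \<le> p < 2\<close>.
\<close>

definition T_tilde :: "2 \<Rightarrow> (real ^ 2 \<Rightarrow> real) \<Rightarrow> real ^ 2 \<Rightarrow> real" where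
  "T_tilde j h x =
     1 / (2 * pi) *
     (LINT y|lebesgue. ((y $ j - x $ j) / norm (y - x) - y $ j / norm y) * h y)"

end

theory Submission
  imports Defs
begin

text \<open>
  Put \<open>d = norm (x - z)\<close>. In \<open>T_tilde j h x - T_tilde j h z\<close> the normalising terms \<open>y / norm y\<close>
  cancel, and what remains is the integral of \<open>h\<close> against a component of the difference of the unit
  vectors pointing from \<open>x\<close> and from \<open>z\<close> to \<open>y\<close>. Since \<open>x\<close> and \<open>z\<close> are \<open>d\<close> apart,
  this difference has norm at most \<open>2 * min 1 (d / norm (y - x))\<close>. Everything
  therefore reduces to pairing \<open>\<bar>h\<bar>\<close> with the radial weight \<open>min 1 (d / norm (y - x))\<close>.

  In the plane this weight behaves like \<open>1 / s\<close> at distance \<open>s\<close> against the area element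
  \<open>2 * pi * s\<close>, so it lies in \<open>L\<^sup>r\<close> exactly for \<open>r > 2\<close>; scaling gives an integral of its
  \<open>r\<close>-th power proportional to \<open>d\<^sup>2\<close>. When \<open>r\<close> is the exponent conjugate to \<open>p < 2\<close>, Hoelder's
  inequality produces the factor \<open>d powr (2 / r) = d powr (2 - 2 / p)\<close>
  (\<open>capped_inverse_Lq_pairing\<close>), which is the first claim.

  For \<open>p = 2\<close> the conjugate exponent is the critical \<open>r = 2\<close>, and the weight fails to be square
  integrable only at infinity, logarithmically. So the integral is cut at distance \<open>1\<close> from \<open>x\<close>.
  Inside, the Cauchy-Schwarz inequality costs a factor \<open>d * sqrt (1 + \<bar>ln d\<bar>)\<close>
  (\<open>capped_inverse_L2_pairing_unit_ball\<close>). Outside, the weight is at most \<open>d\<close> times the weight with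
  parameter \<open>1\<close>, and the pairing of the latter with \<open>\<bar>h\<bar>\<close> is controlled by the \<open>L\<^sup>q\<close> norm of
  \<open>h\<close> through the subcritical estimate.
\<close>

section \<open>Hoelder's inequality\<close>

text \<open>
  Young's inequality for the normalised functions, integrated; without normalisation it already
  gives integrability of the product.
\<close>

lemma Holder_inequality:
  fixes f g :: "'a \<Rightarrow> real"
  assumes pq: "p > 1" "q > 1" "1 / p + 1 / q = 1"
    and [measurable]: "f \<in> borel_measurable M" "g \<in> borel_measurable M"
    and nonneg: "\<And>x. f x \<ge> 0" "\<And>x. g x \<ge> 0"
    and f: "integrable M (\<lambda>x. f x powr p)" and g: "integrable M (\<lambda>x. g x powr q)"
  shows "integrable M (\<lambda>x. f x * g x)"
    and "(LINT x|M. f x * g x) \<le> (LINT x|M. f x powr p) powr (1 / p) * (LINT x|M. g x powr q) powr (1 / q)"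
proof -
  show int: "integrable M (\<lambda>x. f x * g x)"
  proof (rule Bochner_Integration.integrable_bound)
    show "integrable M (\<lambda>x. f x powr p / p + g x powr q / q)"
      using f g by simp
    show "AE x in M. norm (f x * g x) \<le> norm (f x powr p / p + g x powr q / q)"
      using Youngs_inequality[OF pq nonneg] pq nonneg by (auto simp: abs_mult)
  qed simp
  define A where "A = (LINT x|M. f x powr p)"
  define B where "B = (LINT x|M. g x powr q)"
  have AB: "A \<ge> 0" "B \<ge> 0"
    by (simp_all add: A_def B_def)
  show "(LINT x|M. f x * g x) \<le> A powr (1 / p) * B powr (1 / q)"
  proof (cases "A = 0 \<or> B = 0")
    case True
    then have "(AE x in M. f x powr p = 0) \<or> (AE x in M. g x powr q = 0)"
      using integral_nonneg_eq_0_iff_AE[OF f] integral_nonneg_eq_0_iff_AE[OF g]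
      by (simp add: A_def B_def)
    then have "AE x in M. f x * g x = 0"
      by auto
    then have "(LINT x|M. f x * g x) = (LINT x|M. 0)"
      by (intro integral_cong_AE) auto
    then show ?thesis
      by simp
  next
    case False
    with AB have AB: "A > 0" "B > 0"
      by auto
    define a where "a = A powr (1 / p)"
    define b where "b = B powr (1 / q)"
    have ab: "a > 0" "b > 0" "a powr p = A" "b powr q = B"
      using AB pq by (simp_all add: a_def b_def powr_powr)
    have "(LINT x|M. (f x / a) * (g x / b)) \<le> (LINT x|M. f x powr p / A / p + g x powr q / B / q)"
    proof (rule integral_mono)
      show "integrable M (\<lambda>x. f x / a * (g x / b))"
        using integrable_divide[OF int, of "a * b"] by simp
      show "integrable M (\<lambda>x. f x powr p / A / p + g x powr q / B / q)"
        using f g by simp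
      fix x
      show "f x / a * (g x / b) \<le> f x powr p / A / p + g x powr q / B / q"
        using Youngs_inequality[OF pq, of "f x / a" "g x / b"] nonneg[of x] ab
        by (simp add: powr_divide)
    qed
    also have "\<dots> = A / A / p + B / B / q"
      using f g by (simp add: A_def B_def)
    also have "\<dots> = 1"
      using AB pq by simp
    finally have "(LINT x|M. f x * g x) / (a * b) \<le> 1"
      by simp
    then show ?thesis
      using ab by (simp add: a_def b_def field_simps)
  qed
qed

text \<open>
  Turns an upper bound for a nonnegative integral, where no integrability is presupposed, into the
  two facts that the real-valued integral needs.
\<close>

lemma integrable_and_integral_le_of_nn_integral_le:
  fixes f :: "'a \<Rightarrow> real"
  assumes [measurable]: "f \<in> borel_measurable M" and "\<And>x. f x \<ge> 0" and "B \<ge> 0"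
    and "(\<integral>\<^sup>+ x. ennreal (f x) \<partial>M) \<le> ennreal B"
  shows "integrable M f" and "integral\<^sup>L M f \<le> B"
proof -
  show int: "integrable M f"
  proof (rule integrableI_bounded)
    show "(\<integral>\<^sup>+ x. ennreal (norm (f x)) \<partial>M) < \<infinity>"
      using assms by (auto simp: le_less_trans[OF _ ennreal_less_top])
  qed simp
  show "integral\<^sup>L M f \<le> B"
    using assms nn_integral_eq_integral[OF int] by simp
qed

section \<open>Radial integration in the plane\<close>

text \<open>
  Polar coordinates for radial integrands: both measures give \<open>{..t}\<close> the area \<open>pi * t\<^sup>2\<close> of a
  disc of radius \<open>t\<close>, and half-lines generate the Borel sets.
\<close>

lemma distr_dist_lborel_plane:
  fixes x :: "real ^ 2"
  shows "distr lborel borel (\<lambda>y. norm (y - x)) =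
    density lborel (\<lambda>s. ennreal (2 * pi * s) * indicator {0..} s)" (is "?M = ?N")
proof (rule measure_eqI_generator_eq)
  show "Int_stable (range (atMost :: real \<Rightarrow> _))"
    by (auto simp: Int_stable_def)
  show "sets ?M = sigma_sets UNIV (range atMost)" "sets ?N = sigma_sets UNIV (range atMost)"
    by (simp_all add: borel_eq_atMost sets_measure_of_conv)
  show "(\<Union>i. {..real i}) = UNIV"
    using real_arch_simple by blast
  have M: "emeasure ?M {..t} = emeasure lborel (cball x t)" for t
    by (subst emeasure_distr)
      (auto intro!: arg_cong[where f = "emeasure lborel"] simp: dist_norm norm_minus_commute)
  show "emeasure ?M {..real i} \<noteq> \<infinity>" for i :: nat
    by (simp add: M emeasure_cball)
  show "emeasure ?M X = emeasure ?N X" if X: "X \<in> range atMost" for X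
  proof -
    from X obtain t where t: "X = {..t}"
      by blast
    have "emeasure ?N {..t} = (\<integral>\<^sup>+ s. ennreal (2 * pi * s) * indicator {0..t} s \<partial>lborel)"
      by (subst emeasure_density) (auto intro!: nn_integral_cong split: split_indicator)
    also have "\<dots> = emeasure lborel (cball x t)"
    proof (cases "t \<ge> 0")
      case True
      have "(\<integral>\<^sup>+ s. ennreal (2 * pi * s) * indicator {0..t} s \<partial>lborel) = ennreal (pi * t\<^sup>2 - pi * 0\<^sup>2)"
        by (rule nn_integral_FTC_Icc) (use True in \<open>auto intro!: derivative_eq_intros\<close>)
      then show ?thesis
        using True by (simp add: emeasure_cball unit_ball_vol_2)
    qed simp
    finally show ?thesis
      by (simp add: M t)
  qed
qed auto

lemma nn_integral_radial_plane:
  fixes x :: "real ^ 2"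
  assumes [measurable]: "g \<in> borel_measurable borel"
  shows "(\<integral>\<^sup>+ y. g (norm (y - x)) \<partial>lborel) = (\<integral>\<^sup>+ s. ennreal (2 * pi * s) * g s * indicator {0..} s \<partial>lborel)"
proof -
  have "(\<integral>\<^sup>+ y. g (norm (y - x)) \<partial>lborel) = integral\<^sup>N (distr lborel borel (\<lambda>y. norm (y - x))) g"
    by (subst nn_integral_distr) auto
  also have "\<dots> = (\<integral>\<^sup>+ s. ennreal (2 * pi * s) * indicator {0..} s * g s \<partial>lborel)"
    unfolding distr_dist_lborel_plane by (subst nn_integral_density) auto
  finally show ?thesis
    by (simp add: mult_ac)
qed

section \<open>The radial majorant of the kernel\<close>

text \<open>
  This is \<open>min 1 (d / norm v)\<close>, written with a single quotient so that the value at \<open>v = 0\<close> is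
  \<open>1\<close> and not the default \<open>d / 0 = 0\<close>; pointwise bounds then hold at the centre as well.
\<close>

definition capped_inverse :: "real \<Rightarrow> 'a::real_normed_vector \<Rightarrow> real" where
  "capped_inverse d v = d / max d (norm v)"

lemma borel_measurable_capped_inverse [measurable]:
  "capped_inverse d \<in> borel_measurable (borel :: 'a::real_normed_vector measure)"
  unfolding capped_inverse_def[abs_def] by measurable

lemma lebesgue_measurable_capped_inverse [measurable]:
  "(\<lambda>y. capped_inverse d (y - x)) \<in> borel_measurable (lebesgue :: 'a::euclidean_space measure)"
proof (rule measurable_completion)
  show "(\<lambda>y. capped_inverse d (y - x)) \<in> borel_measurable (lborel :: 'a measure)"
    by measurable
qed

lemma capped_inverse_pos: "d > 0 \<Longrightarrow> capped_inverse d v > 0"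
  by (simp add: capped_inverse_def)

lemma capped_inverse_le_1: "d > 0 \<Longrightarrow> capped_inverse d v \<le> 1"
  by (simp add: capped_inverse_def)

text \<open>
  Near \<open>0\<close> the two unit vectors are at most \<open>2\<close> apart. Away from it, scale by \<open>norm a\<close>: the scaled
  difference is \<open>a - b\<close> plus \<open>norm b - norm a\<close> times the direction of \<open>b\<close>,
  and each part has norm at most \<open>norm (a - b)\<close>.
\<close>

lemma norm_sgn_diff_le:
  fixes a b :: "'a::real_normed_vector"
  assumes "a \<noteq> b"
  shows "norm (sgn a - sgn b) \<le> 2 * capped_inverse (norm (a - b)) a"
proof (cases "norm a \<le> norm (a - b)")
  case True
  have "norm (sgn a - sgn b) \<le> norm (sgn a) + norm (sgn b)"
    by (rule norm_triangle_ineq4)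
  also have "\<dots> \<le> 2"
    by (simp add: norm_sgn)
  finally show ?thesis
    using True assms by (simp add: capped_inverse_def max_def)
next
  case False
  then have a: "norm a > 0"
    using norm_ge_zero[of "a - b"] by linarith
  have "norm a * norm (sgn a - sgn b) = norm (norm a *\<^sub>R sgn a - norm a *\<^sub>R sgn b)"
    by (metis abs_norm_cancel norm_scaleR scaleR_diff_right)
  also have "norm a *\<^sub>R sgn a - norm a *\<^sub>R sgn b = (a - b) + (norm b - norm a) *\<^sub>R sgn b"
    using a by (cases "b = 0") (simp_all add: sgn_div_norm algebra_simps)
  also have "norm \<dots> \<le> norm (a - b) + \<bar>norm b - norm a\<bar> * norm (sgn b)"
    by (metis norm_scaleR norm_triangle_ineq)
  also have "\<dots> \<le> norm (a - b) + norm (a - b) * 1"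
    by (intro add_left_mono mult_mono)
      (use norm_triangle_ineq3[of b a] in \<open>simp_all add: norm_sgn norm_minus_commute\<close>)
  finally show ?thesis
    using False a by (simp add: capped_inverse_def max_def field_simps)
qed

text \<open>
  The disc of radius \<open>d\<close>, where the weight is \<open>1\<close>, contributes its area \<open>pi * d\<^sup>2\<close>; the
  complement contributes the integral of \<open>2 * pi * d powr r * s powr (1 - r)\<close> over \<open>s \<ge> d\<close>, which
  is finite because \<open>r > 2\<close>.
\<close>

lemma nn_integral_capped_inverse_powr:
  fixes x :: "real ^ 2"
  assumes d: "d > 0" and r: "r > 2"
  shows "(\<integral>\<^sup>+ y. ennreal (capped_inverse d (y - x) powr r) \<partial>lborel) \<le> ennreal (pi * d\<^sup>2 * r / (r - 2))"
proof -
  have "(\<integral>\<^sup>+ y. ennreal (capped_inverse d (y - x) powr r) \<partial>lborel)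
      = (\<integral>\<^sup>+ s. ennreal (2 * pi * s) * ennreal ((d / max d s) powr r) * indicator {0..} s \<partial>lborel)"
    unfolding capped_inverse_def by (rule nn_integral_radial_plane) simp
  also have "\<dots> \<le> (\<integral>\<^sup>+ s. ennreal (2 * pi * s) * indicator {0..d} s
      + ennreal (2 * pi * d powr r * s powr (1 - r)) * indicator {d..} s \<partial>lborel)"
  proof (rule nn_integral_mono)
    fix s :: real
    have "s * (d / s) powr r = d powr r * s powr (1 - r)" if "s \<ge> d"
      using that d by (simp add: powr_divide powr_diff)
    then show "ennreal (2 * pi * s) * ennreal ((d / max d s) powr r) * indicator {0..} s
      \<le> ennreal (2 * pi * s) * indicator {0..d} s
        + ennreal (2 * pi * d powr r * s powr (1 - r)) * indicator {d..} s"
      using d by (auto simp: max_def indicator_def mult.assoc simp flip: ennreal_mult)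
  qed
  also have "\<dots> = (\<integral>\<^sup>+ s. ennreal (2 * pi * s) * indicator {0..d} s \<partial>lborel)
      + (\<integral>\<^sup>+ s. ennreal (2 * pi * d powr r * s powr (1 - r)) * indicator {d..} s \<partial>lborel)"
    by (rule nn_integral_add) auto
  also have "(\<integral>\<^sup>+ s. ennreal (2 * pi * s) * indicator {0..d} s \<partial>lborel) = ennreal (pi * d\<^sup>2 - pi * 0\<^sup>2)"
    by (rule nn_integral_FTC_Icc) (use d in \<open>auto intro!: derivative_eq_intros\<close>)
  also have "(\<integral>\<^sup>+ s. ennreal (2 * pi * d powr r * s powr (1 - r)) * indicator {d..} s \<partial>lborel)
      = ennreal (0 - 2 * pi * d powr r * (d powr (2 - r) / (2 - r)))"
  proof (rule nn_integral_FTC_atLeast[where F = "\<lambda>s. 2 * pi * d powr r * (s powr (2 - r) / (2 - r))"])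
    show "((\<lambda>s. 2 * pi * d powr r * (s powr (2 - r) / (2 - r))) has_real_derivative
        2 * pi * d powr r * s powr (1 - r)) (at s)" if "d \<le> s" for s
      using that d r by (auto intro!: derivative_eq_intros)
    have "((\<lambda>s. s powr (2 - r)) \<longlongrightarrow> 0) at_top"
      using r by (intro tendsto_neg_powr filterlim_ident) auto
    then show "((\<lambda>s. 2 * pi * d powr r * (s powr (2 - r) / (2 - r))) \<longlongrightarrow> 0) at_top"
      using tendsto_mult_left[of _ 0 at_top "2 * pi * d powr r / (2 - r)"] by fastforce
  qed auto
  also have "0 - 2 * pi * d powr r * (d powr (2 - r) / (2 - r)) = 2 * pi * d\<^sup>2 / (r - 2)"
    using d r by (simp add: powr_add[symmetric] field_simps flip: powr_numeral)
  also have "ennreal (pi * d\<^sup>2 - pi * 0\<^sup>2) + ennreal (2 * pi * d\<^sup>2 / (r - 2)) = ennreal (pi * d\<^sup>2 * r / (r - 2))"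
    using d r by (simp add: field_simps flip: ennreal_plus)
  finally show ?thesis .
qed

text \<open>
  At the critical exponent the tail integrand is \<open>2 * pi * d\<^sup>2 / s\<close>, whose integral from \<open>d\<close> to
  \<open>1\<close> is logarithmic in \<open>d\<close>.
\<close>

lemma nn_integral_capped_inverse_square_unit_ball:
  fixes x :: "real ^ 2"
  assumes d: "d > 0"
  shows "(\<integral>\<^sup>+ y. ennreal ((indicator (cball x 1) y * capped_inverse d (y - x)) powr 2) \<partial>lborel)
    \<le> ennreal (2 * pi * d\<^sup>2 * (\<bar>ln d\<bar> + 1))"
proof -
  have "(\<integral>\<^sup>+ y. ennreal ((indicator (cball x 1) y * capped_inverse d (y - x)) powr 2) \<partial>lborel)
      = (\<integral>\<^sup>+ y. ennreal (indicator {..1} (norm (y - x)) * (d / max d (norm (y - x))) powr 2) \<partial>lborel)"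
    by (intro nn_integral_cong)
      (auto simp: capped_inverse_def indicator_def dist_norm norm_minus_commute)
  also have "\<dots> = (\<integral>\<^sup>+ s. ennreal (2 * pi * s) * ennreal (indicator {..1} s * (d / max d s) powr 2)
      * indicator {0..} s \<partial>lborel)"
    by (rule nn_integral_radial_plane) simp
  \<comment> \<open>The upper limit \<open>max d 1\<close> keeps the second interval nonempty when \<open>d > 1\<close>.\<close>
  also have "\<dots> \<le> (\<integral>\<^sup>+ s. ennreal (2 * pi * s) * indicator {0..d} s
      + ennreal (2 * pi * d\<^sup>2 / s) * indicator {d..max d 1} s \<partial>lborel)"
  proof (rule nn_integral_mono)
    fix s :: real
    have "s * (d / s) powr 2 = d\<^sup>2 / s" if "s \<ge> d"
      using that d by (simp add: power2_eq_square)
    then show "ennreal (2 * pi * s) * ennreal (indicator {..1} s * (d / max d s) powr 2) * indicator {0..} s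
      \<le> ennreal (2 * pi * s) * indicator {0..d} s
        + ennreal (2 * pi * d\<^sup>2 / s) * indicator {d..max d 1} s"
      using d by (auto simp: max_def indicator_def mult.assoc simp flip: ennreal_mult times_divide_eq_right)
  qed
  also have "\<dots> = (\<integral>\<^sup>+ s. ennreal (2 * pi * s) * indicator {0..d} s \<partial>lborel)
      + (\<integral>\<^sup>+ s. ennreal (2 * pi * d\<^sup>2 / s) * indicator {d..max d 1} s \<partial>lborel)"
    by (rule nn_integral_add) auto
  also have "(\<integral>\<^sup>+ s. ennreal (2 * pi * s) * indicator {0..d} s \<partial>lborel) = ennreal (pi * d\<^sup>2 - pi * 0\<^sup>2)"
    by (rule nn_integral_FTC_Icc) (use d in \<open>auto intro!: derivative_eq_intros\<close>)
  also have "(\<integral>\<^sup>+ s. ennreal (2 * pi * d\<^sup>2 / s) * indicator {d..max d 1} s \<partial>lborel)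
      = ennreal (2 * pi * d\<^sup>2 * ln (max d 1) - 2 * pi * d\<^sup>2 * ln d)"
    by (rule nn_integral_FTC_Icc) (use d in \<open>auto intro!: derivative_eq_intros\<close>)
  also have "ennreal (pi * d\<^sup>2 - pi * 0\<^sup>2) + ennreal (2 * pi * d\<^sup>2 * ln (max d 1) - 2 * pi * d\<^sup>2 * ln d)
      = ennreal (pi * d\<^sup>2 * (1 + 2 * (ln (max d 1) - ln d)))"
    using d by (subst ennreal_plus[symmetric]) (auto simp: algebra_simps)
  also have "\<dots> \<le> ennreal (2 * pi * d\<^sup>2 * (\<bar>ln d\<bar> + 1))"
  proof (rule ennreal_leI)
    have "1 + 2 * (ln (max d 1) - ln d) \<le> 2 * (\<bar>ln d\<bar> + 1)"
      using d by (auto simp: max_def)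
    then show "pi * d\<^sup>2 * (1 + 2 * (ln (max d 1) - ln d)) \<le> 2 * pi * d\<^sup>2 * (\<bar>ln d\<bar> + 1)"
      using mult_left_mono[of "1 + 2 * (ln (max d 1) - ln d)" "2 * (\<bar>ln d\<bar> + 1)" "pi * d\<^sup>2"]
      by (simp only: mult_ac) simp
  qed
  finally show ?thesis .
qed


section \<open>Pairing the majorant with Lebesgue functions\<close>

text \<open>
  Hoelder's inequality with the conjugate exponent \<open>r > 2\<close>, for which the weight has finite norm
  proportional to \<open>d powr (2 / r)\<close>. For \<open>q = 1\<close> the conjugate exponent is infinite and the bound
  \<open>1\<close> on the weight takes its place. Integrability is part of the conclusion, since the integral
  that defines \<open>T_tilde\<close> can be split only where it converges.
\<close>

lemma capped_inverse_Lq_pairing: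
  assumes q: "1 \<le> q" "q < 2"
  shows "\<exists>C\<ge>0. \<forall>d (x :: real ^ 2) h. d > 0 \<longrightarrow> Lp_fun q h \<longrightarrow>
    integrable lebesgue (\<lambda>y. capped_inverse d (y - x) * \<bar>h y\<bar>) \<and>
    (LINT y|lebesgue. capped_inverse d (y - x) * \<bar>h y\<bar>) \<le> C * d powr (2 - 2 / q) * Lp_norm q h"
proof (cases "q = 1")
  case True
  have *: "integrable lebesgue (\<lambda>y. capped_inverse d (y - x) * \<bar>h y\<bar>)"
    "(LINT y|lebesgue. capped_inverse d (y - x) * \<bar>h y\<bar>) \<le> 1 * d powr (2 - 2 / q) * Lp_norm q h"
    if d: "d > 0" and h: "Lp_fun q h" for d x and h :: "real ^ 2 \<Rightarrow> real"
  proof -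
    have [measurable]: "h \<in> borel_measurable lebesgue" and int: "integrable lebesgue (\<lambda>y. \<bar>h y\<bar>)"
      using h True by (auto simp: Lp_fun_def)
    have le: "capped_inverse d (y - x) * \<bar>h y\<bar> \<le> \<bar>h y\<bar>" for y
      using mult_right_mono[OF capped_inverse_le_1[OF d], of "\<bar>h y\<bar>"] by simp
    show *: "integrable lebesgue (\<lambda>y. capped_inverse d (y - x) * \<bar>h y\<bar>)"
      by (rule Bochner_Integration.integrable_bound[OF int])
        (use le in \<open>auto simp: abs_mult abs_of_pos[OF capped_inverse_pos[OF d]]\<close>)
    show "(LINT y|lebesgue. capped_inverse d (y - x) * \<bar>h y\<bar>) \<le> 1 * d powr (2 - 2 / q) * Lp_norm q h"
      using integral_mono[OF * int le] d True by (simp add: Lp_norm_def)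
  qed
  show ?thesis
    by (rule exI[of _ 1]) (use * in auto)
next
  case False
  define r where "r = q / (q - 1)"
  have r: "r > 2" "1 / r + 1 / q = 1" "2 / r = 2 - 2 / q"
    using q False by (simp_all add: r_def field_simps)
  define C where "C = (pi * r / (r - 2)) powr (1 / r)"
  have *: "integrable lebesgue (\<lambda>y. capped_inverse d (y - x) * \<bar>h y\<bar>)"
    "(LINT y|lebesgue. capped_inverse d (y - x) * \<bar>h y\<bar>) \<le> C * d powr (2 - 2 / q) * Lp_norm q h"
    if d: "d > 0" and h: "Lp_fun q h" for d x and h :: "real ^ 2 \<Rightarrow> real"
  proof -
    have [measurable]: "h \<in> borel_measurable lebesgue" and int: "integrable lebesgue (\<lambda>y. \<bar>h y\<bar> powr q)"
      using h by (auto simp: Lp_fun_def)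
    have B: "pi * d\<^sup>2 * r / (r - 2) \<ge> 0"
      using r by simp
    have nn: "(\<integral>\<^sup>+ y. ennreal (capped_inverse d (y - x) powr r) \<partial>lebesgue) \<le> ennreal (pi * d\<^sup>2 * r / (r - 2))"
      using nn_integral_capped_inverse_powr[OF d r(1)] by (simp add: nn_integral_completion)
    note k = integrable_and_integral_le_of_nn_integral_le[OF _ _ B nn, simplified]
    have pos: "capped_inverse d v \<ge> 0" for v :: "real ^ 2"
      using capped_inverse_pos[OF d, of v] by simp
    have rq: "r > 1" "q > 1"
      using r q False by auto
    note H = Holder_inequality[OF rq r(2) _ _ pos abs_ge_zero k(1) int]
    show "integrable lebesgue (\<lambda>y. capped_inverse d (y - x) * \<bar>h y\<bar>)"
      by (rule H) simp_all
    have H2: "(LINT y|lebesgue. capped_inverse d (y - x) * \<bar>h y\<bar>) \<le>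
        (LINT y|lebesgue. capped_inverse d (y - x) powr r) powr (1 / r) * Lp_norm q h"
      unfolding Lp_norm_def by (rule H) simp_all
    have "(LINT y|lebesgue. capped_inverse d (y - x) powr r) powr (1 / r)
        \<le> (pi * d\<^sup>2 * r / (r - 2)) powr (1 / r)"
      using r k(2) by (intro powr_mono2) auto
    also have "\<dots> = ((pi * r / (r - 2)) * d\<^sup>2) powr (1 / r)"
      by (simp add: mult_ac)
    also have "\<dots> = C * (d powr 2) powr (1 / r)"
      using r d by (subst powr_mult) (auto simp: C_def)
    also have "\<dots> = C * d powr (2 - 2 / q)"
      using r(3) by (simp add: powr_powr)
    finally have "(LINT y|lebesgue. capped_inverse d (y - x) powr r) powr (1 / r) * Lp_norm q h
        \<le> C * d powr (2 - 2 / q) * Lp_norm q h"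
      by (rule mult_right_mono) (simp add: Lp_norm_def)
    with H2 show "(LINT y|lebesgue. capped_inverse d (y - x) * \<bar>h y\<bar>) \<le> C * d powr (2 - 2 / q) * Lp_norm q h"
      by (rule order_trans)
  qed
  show ?thesis
    by (rule exI[of _ C]) (use * in \<open>auto simp: C_def\<close>)
qed

lemma capped_inverse_L2_pairing_unit_ball:
  fixes x :: "real ^ 2"
  assumes d: "d > 0" and h: "Lp_fun 2 h"
  shows "integrable lebesgue (\<lambda>y. indicator (cball x 1) y * capped_inverse d (y - x) * \<bar>h y\<bar>)"
    and "(LINT y|lebesgue. indicator (cball x 1) y * capped_inverse d (y - x) * \<bar>h y\<bar>)
      \<le> sqrt (2 * pi) * d * (\<bar>ln d\<bar> + 1) powr (1 / 2) * Lp_norm 2 h"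
proof -
  let ?k = "\<lambda>y. indicator (cball x 1) y * capped_inverse d (y - x) :: real"
  have [measurable]: "h \<in> borel_measurable lebesgue" and int: "integrable lebesgue (\<lambda>y. \<bar>h y\<bar> powr 2)"
    using h by (auto simp: Lp_fun_def)
  have B: "2 * pi * d\<^sup>2 * (\<bar>ln d\<bar> + 1) \<ge> 0"
    by simp
  have nn: "(\<integral>\<^sup>+ y. ennreal (?k y powr 2) \<partial>lebesgue) \<le> ennreal (2 * pi * d\<^sup>2 * (\<bar>ln d\<bar> + 1))"
    using nn_integral_capped_inverse_square_unit_ball[OF d] by (simp add: nn_integral_completion)
  have meas [measurable]: "?k \<in> borel_measurable lebesgue"
    by (intro borel_measurable_times borel_measurable_indicator) auto
  have k: "integrable lebesgue (\<lambda>y. ?k y powr 2)"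
    by (rule integrable_and_integral_le_of_nn_integral_le[OF _ _ B nn]) simp_all
  have k2: "(LINT y|lebesgue. ?k y powr 2) \<le> 2 * pi * d\<^sup>2 * (\<bar>ln d\<bar> + 1)"
    by (rule integrable_and_integral_le_of_nn_integral_le[OF _ _ B nn]) simp_all
  have pos: "?k y \<ge> 0" for y
    using capped_inverse_pos[OF d, of "y - x"] by simp
  note H = Holder_inequality[of 2 2 ?k lebesgue "\<lambda>y. \<bar>h y\<bar>", OF _ _ _ meas _ pos abs_ge_zero k int]
  show "integrable lebesgue (\<lambda>y. ?k y * \<bar>h y\<bar>)"
    by (rule H) simp_all
  have H2: "(LINT y|lebesgue. ?k y * \<bar>h y\<bar>) \<le> (LINT y|lebesgue. ?k y powr 2) powr (1 / 2) * Lp_norm 2 h"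
    unfolding Lp_norm_def by (rule H) simp_all
  have "(LINT y|lebesgue. ?k y powr 2) powr (1 / 2) \<le> (2 * pi * d\<^sup>2 * (\<bar>ln d\<bar> + 1)) powr (1 / 2)"
    using k2 by (intro powr_mono2) auto
  also have "\<dots> = sqrt (2 * pi) * d * (\<bar>ln d\<bar> + 1) powr (1 / 2)"
    using d by (simp add: powr_half_sqrt real_sqrt_mult)
  finally have "(LINT y|lebesgue. ?k y powr 2) powr (1 / 2) * Lp_norm 2 h
      \<le> sqrt (2 * pi) * d * (\<bar>ln d\<bar> + 1) powr (1 / 2) * Lp_norm 2 h"
    by (rule mult_right_mono) (simp add: Lp_norm_def)
  with H2 show "(LINT y|lebesgue. ?k y * \<bar>h y\<bar>)
      \<le> sqrt (2 * pi) * d * (\<bar>ln d\<bar> + 1) powr (1 / 2) * Lp_norm 2 h"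
    by (rule order_trans)
qed

section \<open>Regularity of the operators\<close>

text \<open>
  Both integrals defining the values of \<open>T_tilde\<close> converge absolutely, by the pairing estimate
  applied to the pairs \<open>(x, 0)\<close> and \<open>(z, 0)\<close>; subtracting them leaves the kernel for the pair
  \<open>(x, z)\<close>. The factor \<open>2\<close> in the kernel bound is absorbed by \<open>1 / (2 * pi)\<close>.
\<close>

lemma abs_T_tilde_diff_le:
  fixes x z :: "real ^ 2"
  assumes q: "1 \<le> q" "q < 2" and h: "Lp_fun q h" and "x \<noteq> z"
  shows "\<bar>T_tilde j h x - T_tilde j h z\<bar>
    \<le> (LINT y|lebesgue. capped_inverse (norm (x - z)) (y - x) * \<bar>h y\<bar>)"
proof -
  have [measurable]: "h \<in> borel_measurable lebesgue"
    using h by (auto simp: Lp_fun_def)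
  obtain C where C0: "C \<ge> 0"
    and Cint: "\<And>d (x :: real ^ 2) h. d > 0 \<Longrightarrow> Lp_fun q h \<Longrightarrow>
      integrable lebesgue (\<lambda>y. capped_inverse d (y - x) * \<bar>h y\<bar>)"
    and Cle: "\<And>d (x :: real ^ 2) h. d > 0 \<Longrightarrow> Lp_fun q h \<Longrightarrow>
      (LINT y|lebesgue. capped_inverse d (y - x) * \<bar>h y\<bar>) \<le> C * d powr (2 - 2 / q) * Lp_norm q h"
    using capped_inverse_Lq_pairing[OF q] by blast
  define K where "K u w = (\<lambda>y. (sgn (y - u) - sgn (y - w)) $ j * h y)" for u w :: "real ^ 2"
  have le: "\<bar>K u w y\<bar> \<le> 2 * (capped_inverse (norm (u - w)) (y - u) * \<bar>h y\<bar>)" if "u \<noteq> w" for u w y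
  proof -
    have "\<bar>K u w y\<bar> \<le> norm (sgn (y - u) - sgn (y - w)) * \<bar>h y\<bar>"
      unfolding K_def abs_mult by (intro mult_right_mono component_le_norm_cart) simp
    also have "\<dots> \<le> 2 * capped_inverse (norm (u - w)) (y - u) * \<bar>h y\<bar>"
      using norm_sgn_diff_le[of "y - u" "y - w"] that
      by (intro mult_right_mono) (auto simp: norm_minus_commute)
    finally show ?thesis
      by (simp add: mult_ac)
  qed
  have meas: "K u w \<in> borel_measurable lebesgue" for u w
  proof -
    have "(\<lambda>y. (sgn (y - u) - sgn (y - w)) $ j) \<in> borel_measurable borel"
      unfolding cart_eq_inner_axis sgn_div_norm by measurable
    then have [measurable]: "(\<lambda>y. (sgn (y - u) - sgn (y - w)) $ j) \<in> borel_measurable lebesgue"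
      by (intro measurable_completion) simp
    show ?thesis
      unfolding K_def by measurable
  qed
  have int: "integrable lebesgue (K u w)" for u w
  proof (cases "u = w")
    case False
    then have d: "norm (u - w) > 0"
      by simp
    have "integrable lebesgue (\<lambda>y. 2 * (capped_inverse (norm (u - w)) (y - u) * \<bar>h y\<bar>))"
      using Cint[OF d h] by simp
    then show ?thesis
      by (rule Bochner_Integration.integrable_bound[OF _ meas])
        (use le[OF False, THEN order_trans[OF _ abs_ge_self]] in simp)
  qed (simp add: K_def)
  have "(sgn (y - u) - sgn y) $ j = (y $ j - u $ j) / norm (y - u) - y $ j / norm y" for y u
    by (simp add: sgn_div_norm divide_inverse mult.commute)
  then have T: "T_tilde j h u = 1 / (2 * pi) * (LINT y|lebesgue. K u 0 y)" for u
    by (simp add: T_tilde_def K_def del: vector_minus_component)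
  have "T_tilde j h x - T_tilde j h z = 1 / (2 * pi) * (LINT y|lebesgue. K x 0 y - K z 0 y)"
    unfolding T by (simp add: int right_diff_distrib)
  also have "(\<lambda>y. K x 0 y - K z 0 y) = K x z"
    by (auto simp: K_def algebra_simps)
  finally have "\<bar>T_tilde j h x - T_tilde j h z\<bar> = 1 / (2 * pi) * \<bar>LINT y|lebesgue. K x z y\<bar>"
    by (simp add: abs_mult)
  also have "\<dots> \<le> 1 / (2 * pi) * (LINT y|lebesgue. 2 * (capped_inverse (norm (x - z)) (y - x) * \<bar>h y\<bar>))"
  proof (intro mult_left_mono)
    have "\<bar>LINT y|lebesgue. K x z y\<bar> \<le> (LINT y|lebesgue. \<bar>K x z y\<bar>)"
      by (rule integral_abs_bound)
    also have "\<dots> \<le> (LINT y|lebesgue. 2 * (capped_inverse (norm (x - z)) (y - x) * \<bar>h y\<bar>))"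
      using int Cint[OF _ h, of "norm (x - z)" x] le \<open>x \<noteq> z\<close> by (intro integral_mono) auto
    finally show "\<bar>LINT y|lebesgue. K x z y\<bar>
        \<le> (LINT y|lebesgue. 2 * (capped_inverse (norm (x - z)) (y - x) * \<bar>h y\<bar>))" .
  qed simp
  also have "\<dots> = (1 / pi) * (LINT y|lebesgue. capped_inverse (norm (x - z)) (y - x) * \<bar>h y\<bar>)"
    by simp
  also have "\<dots> \<le> 1 * (LINT y|lebesgue. capped_inverse (norm (x - z)) (y - x) * \<bar>h y\<bar>)"
    using pi_ge_two \<open>x \<noteq> z\<close>
    by (intro mult_right_mono integral_nonneg_AE) (auto simp: capped_inverse_pos less_imp_le)
  finally show ?thesis
    by simp
qed

text \<open>
  The cut at distance \<open>1\<close>: beyond it, \<open>capped_inverse 1 v\<close> equals \<open>1 / norm v\<close>, and \<open>d\<close> times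
  this dominates \<open>capped_inverse d v\<close>.
\<close>

lemma capped_inverse_split:
  assumes "d > 0"
  shows "capped_inverse d (y - x) \<le> indicator (cball x 1) y * capped_inverse d (y - x) + d * capped_inverse 1 (y - x)"
proof (cases "norm (y - x) \<le> 1")
  case True
  then have "y \<in> cball x 1"
    by (simp add: dist_norm norm_minus_commute)
  then show ?thesis
    using assms by (simp add: capped_inverse_def)
next
  case False
  then have "capped_inverse d (y - x) \<le> d * capped_inverse 1 (y - x)"
    using assms by (auto simp: capped_inverse_def intro!: frac_le)
  also have "\<dots> \<le> indicator (cball x 1) y * capped_inverse d (y - x) + d * capped_inverse 1 (y - x)"
    using assms by (simp add: capped_inverse_def)
  finally show ?thesis .
qed

lemma T_tilde_Hoelder_continuous:
  assumes p: "1 \<le> p" "p < 2"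
  shows "\<exists>C. \<forall>(x::real ^ 2) z h j. Lp_fun p h \<longrightarrow>
    \<bar>T_tilde j h x - T_tilde j h z\<bar> \<le> C * norm (x - z) powr (2 - 2 / p) * Lp_norm p h"
proof -
  obtain C where C0: "C \<ge> 0"
    and Cint: "\<And>d (x :: real ^ 2) h. d > 0 \<Longrightarrow> Lp_fun p h \<Longrightarrow>
      integrable lebesgue (\<lambda>y. capped_inverse d (y - x) * \<bar>h y\<bar>)"
    and Cle: "\<And>d (x :: real ^ 2) h. d > 0 \<Longrightarrow> Lp_fun p h \<Longrightarrow>
      (LINT y|lebesgue. capped_inverse d (y - x) * \<bar>h y\<bar>) \<le> C * d powr (2 - 2 / p) * Lp_norm p h"
    using capped_inverse_Lq_pairing[OF p] by blast
  have "\<bar>T_tilde j h x - T_tilde j h z\<bar> \<le> C * norm (x - z) powr (2 - 2 / p) * Lp_norm p h"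
    if h: "Lp_fun p h" for x z h j
  proof (cases "x = z")
    case False
    then have "norm (x - z) > 0"
      by simp
    from abs_T_tilde_diff_le[OF p h False] Cle[OF this h] show ?thesis
      by (rule order_trans)
  qed simp
  then show ?thesis
    by blast
qed

text \<open>
  The part near \<open>x\<close> is paired in \<open>L\<^sup>2\<close> and carries the logarithm. The far part is paired in
  \<open>L\<^sup>q\<close> with the fixed weight of parameter \<open>1\<close> and is linear in \<open>d\<close>. The logarithmic factor is
  at least \<open>1\<close>, so both parts fit under the same bound.
\<close>

lemma T_tilde_log_Lipschitz:
  assumes q: "1 \<le> q" "q < 2"
  shows "\<exists>C. \<forall>(x::real ^ 2) z h j. Lp_fun 2 h \<and> Lp_fun q h \<longrightarrow>
    \<bar>T_tilde j h x - T_tilde j h z\<bar>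
      \<le> C * norm (x - z) * (\<bar>ln (norm (x - z))\<bar> + 1) powr (1 / 2) * (Lp_norm 2 h + Lp_norm q h)"
proof -
  obtain C where C0: "C \<ge> 0"
    and Cint: "\<And>d (x :: real ^ 2) h. d > 0 \<Longrightarrow> Lp_fun q h \<Longrightarrow>
      integrable lebesgue (\<lambda>y. capped_inverse d (y - x) * \<bar>h y\<bar>)"
    and Cle: "\<And>d (x :: real ^ 2) h. d > 0 \<Longrightarrow> Lp_fun q h \<Longrightarrow>
      (LINT y|lebesgue. capped_inverse d (y - x) * \<bar>h y\<bar>) \<le> C * d powr (2 - 2 / q) * Lp_norm q h"
    using capped_inverse_Lq_pairing[OF q] by blast
  define A where "A = max C (sqrt (2 * pi))"
  have "\<bar>T_tilde j h x - T_tilde j h z\<bar>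
      \<le> A * norm (x - z) * (\<bar>ln (norm (x - z))\<bar> + 1) powr (1 / 2) * (Lp_norm 2 h + Lp_norm q h)"
    if h: "Lp_fun 2 h" "Lp_fun q h" for x z h j
  proof (cases "x = z")
    case False
    define d where "d = norm (x - z)"
    have d: "d > 0"
      using False by (simp add: d_def)
    let ?L = "(\<bar>ln d\<bar> + 1) powr (1 / 2)"
    have L: "1 \<le> ?L"
      by (simp add: ge_one_powr_ge_zero)
    note near = capped_inverse_L2_pairing_unit_ball[OF d h(1), of x]
    have "\<bar>T_tilde j h x - T_tilde j h z\<bar> \<le> (LINT y|lebesgue. capped_inverse d (y - x) * \<bar>h y\<bar>)"
      using abs_T_tilde_diff_le[OF q h(2) False] by (simp add: d_def)
    also have "\<dots> \<le> (LINT y|lebesgue. indicator (cball x 1) y * capped_inverse d (y - x) * \<bar>h y\<bar>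
        + d * (capped_inverse 1 (y - x) * \<bar>h y\<bar>))"
      using Cint[OF d h(2)] Cint[OF zero_less_one h(2)] near(1)
        mult_right_mono[OF capped_inverse_split[OF d], of "\<bar>h _\<bar>"]
      by (intro integral_mono) (auto simp: algebra_simps)
    also have "\<dots> = (LINT y|lebesgue. indicator (cball x 1) y * capped_inverse d (y - x) * \<bar>h y\<bar>)
        + d * (LINT y|lebesgue. capped_inverse 1 (y - x) * \<bar>h y\<bar>)"
      using near(1) Cint[OF zero_less_one h(2)] by simp
    also have "\<dots> \<le> sqrt (2 * pi) * d * ?L * Lp_norm 2 h + d * (C * Lp_norm q h)"
      using near(2) Cle[OF zero_less_one h(2), of x] d by (intro add_mono mult_left_mono) auto
    also have "\<dots> \<le> A * d * ?L * Lp_norm 2 h + d * (A * ?L * Lp_norm q h)"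
    proof (intro add_mono mult_left_mono mult_right_mono)
      show "C \<le> A * ?L"
        using mult_mono[of C A 1 ?L] L C0 by (simp add: A_def)
    qed (use d in \<open>auto simp: A_def Lp_norm_def\<close>)
    finally show ?thesis
      by (simp add: d_def algebra_simps)
  qed simp
  then show ?thesis
    by blast
qed

theorem theorem1p2:
  fixes p :: real
  assumes "1 < p" and "p \<le> 2"
  shows
    "(p < 2 \<longrightarrow>
       (\<exists>C::real. \<forall>(x::real ^ 2) (z::real ^ 2) (h::real ^ 2 \<Rightarrow> real) (j::2).
          Lp_fun p h \<longrightarrow>
          \<bar>T_tilde j h x - T_tilde j h z\<bar> \<le> C * norm (x - z) powr (2 - 2 / p) * Lp_norm p h))
     \<and>
     (\<forall>q::real. p = 2 \<and> 1 \<le> q \<and> q < 2 \<longrightarrow>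
       (\<exists>C::real. \<forall>(x::real ^ 2) (z::real ^ 2) (h::real ^ 2 \<Rightarrow> real) (j::2).
          Lp_fun 2 h \<and> Lp_fun q h \<longrightarrow>
          \<bar>T_tilde j h x - T_tilde j h z\<bar>
            \<le> C * norm (x - z) * (\<bar>ln (norm (x - z))\<bar> + 1) powr (1 / 2)
                * (Lp_norm 2 h + Lp_norm q h)))"
  using T_tilde_Hoelder_continuous[of p] T_tilde_log_Lipschitz assms by simp

end
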